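(* Let $L\in\mathrm{Lin}\,\mathbb H$ be symmetric, let $P:\mathbb H_{\rm eff}^*\to\mathbb H^*$ be an injective embedding map with pseudo inverse $P^I$, and let $P_0:\mathbb H_0^*\to\mathbb H^*$ be a surjective reference map with pseudo inverse $P_0^I$. Let $R:\mathbb H_{\rm eff}^*\to\mathbb H^*$ and $L':\mathbb H_{\rm eff}^*\to\mathbb H_{\rm eff}^*$ be linear mappings with $R\psi_{\rm eff}\in\mathbb H$ and $L'\psi_{\rm eff}\in\mathbb H_{\rm eff}$ for all $\psi_{\rm eff}\in\mathbb H_{\rm eff}$, and $$P_0^TLR+P_0^TPL'=P_0^TLP,\qquad P^TR=0,$$ and put $L_{\rm eff}:=P^TLP-R^TLR$. (i) If $\mathrm{Im}\,L$ is positive semidefinite, then $\mathrm{Im}\,L_{\rm eff}$ is positive semidefinite. If also $\bar P_0=P_0$, then also $\mathrm{Im}\,P_0^TLP_0$ is positive semidefinite. (ii) Let $\psi\in\mathbb H^*$, $\psi_{\rm eff}\in\mathbb H_{\rm eff}^*$, $\psi_0\in\mathbb H_0^*$ be arbitrary vectors satisfying either $$\psi_{\rm eff}=P^I\psi,\qquad\psi_0=P_0^I(\psi-(P-R)\psi_{\rm eff}),$$ or $$P^TP_0\psi_0=0,\qquad\psi=(P-R)\psi_{\rm eff}+P_0\psi_0 .$$ Then $$L\psi=0\iff L_{\rm eff}\psi_{\rm eff}=0\ \text{ and }\ P_0^TLP_0\psi_0=0 .$$ In particular, to find all solutions of $L\psi=0$ it suffices to solve the two problems $L_{\rm eff}\psi_{\rm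 eff}=0$ and $\{P_0^TLP_0\psi_0=0,\ P^TP_0\psi_0=0\}$; that is, the solutions $\psi\in\mathbb H^*$ of $L\psi=0$ are exactly the vectors $\psi=(P-R)\psi_{\rm eff}+P_0\psi_0$ with $\psi_{\rm eff}\in\mathbb H_{\rm eff}^*$, $\psi_0\in\mathbb H_0^*$ solving these two problems.
   Context: Spaces. $\mathrm{Lin}(V,W)$ is the space of continuous linear maps between topological vector spaces and $\mathrm{Lin}\,V=\mathrm{Lin}(V,V)$. $\mathbb H$, $\mathbb H_{\rm eff}$, $\mathbb H_0$ are complex topological vector spaces, each with a complex conjugation $\varphi\mapsto\bar\varphi$ and a continuous symmetric bilinear form $\varphi^T\psi$ that is compatible with conjugation and definite in the sense that $\varphi^*\psi:=\bar\varphi^T\psi$ is a positive definite Hermitian inner product. $\mathbb H^*$ is the continuous dual, with pairing $\varphi^T\psi=\psi^T\varphi$ for $\varphi\in\mathbb H$, $\psi\in\mathbb H^*$; the bilinear form embeds $\mathbb H$ into $\mathbb H^*$ (same for $\mathbb H_{\rm eff},\mathbb H_0$). Operators. $A\in\mathrm{Lin}\,\mathbb H$ is symmetric if $(A\varphi)^T\psi=\varphi^TA\psi$ for all $\varphi,\psi\in\mathbb H$; it is then extended to $\mathbb H^*$ by $\varphi^TA\psi=(A\varphi)^T\psi$ for $\varphi\in\mathbb H,\psi\in\mathbb H^*$. $A^*=\bar A^T$ is the adjoint, $\mathrm{Im}\,A=\frac1{2i}(A-A^* )$, and $A$ is positive semidefinite if $\psi^*A\psi\ge0$ for all $\psi\in\mathbb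 H$ (same terminology for $\mathbb H_{\rm eff}$, $\mathbb H_0$). All products are compositions of operators on the dual spaces. Maps between dual spaces. A map $S$ ($S=P$, $P_0$, $R$) from $\mathbb K^*$ to $\mathbb H^*$ ($\mathbb K=\mathbb H_{\rm eff}$ or $\mathbb H_0$) sending $\mathbb K$ into $\mathbb H$ has a transpose $S^T$ mapping $\mathbb H^*$ to $\mathbb K^*$ and $\mathbb H$ to $\mathbb K$, with $(S^T\psi)^T\eta=\psi^TS\eta$ for $\psi\in\mathbb H^*,\eta\in\mathbb K$ and $(S^T\varphi)^T\chi=\varphi^TS\chi$ for $\varphi\in\mathbb H,\chi\in\mathbb K^*$; $L'$ is treated analogously. $\bar S=S$ means that $S$ commutes with conjugation. $P:\mathbb H_{\rm eff}^*\to\mathbb H^*$ is closed, injective, linear, with $\bar P=P$ and $P\mathbb H_{\rm eff}\subseteq\mathbb H$; $P^TP$ is invertible (on $\mathbb H_{\rm eff}^*$ and on $\mathbb H_{\rm eff}$), and $P^I=(P^TP)^{-1}P^T$. $P_0:\mathbb H_0^*\to\mathbb H^*$ is closed, surjective, linear, with $P_0\mathbb H_0\subseteq\mathbb H$; $P_0P_0^T$ is invertible (on $\mathbb H^*$ and on $\mathbb H$), and $P_0^I=P_0^T(P_0P_0^T)^{-1}$, so $P_0P_0^I=1$. *)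

theory Defs
  imports "HOL-Analysis.Analysis"
begin

class scaleC =
  fixes scaleC :: "complex \<Rightarrow> 'a \<Rightarrow> 'a"  (infixr \<open>*\<^sub>C\<close> 75)

class complex_vector = scaleC + ab_group_add +
  assumes scaleC_add_right: "c *\<^sub>C (x + y) = c *\<^sub>C x + c *\<^sub>C y"
    and scaleC_add_left: "(c + d) *\<^sub>C x = c *\<^sub>C x + d *\<^sub>C x"
    and scaleC_scaleC: "c *\<^sub>C d *\<^sub>C x = (c * d) *\<^sub>C x"
    and scaleC_one: "1 *\<^sub>C x = x"

lemma vector_space_scaleC: "vector_space (scaleC :: complex \<Rightarrow> 'a::complex_vector \<Rightarrow> 'a)"
  by unfold_locales (simp_all add: scaleC_add_right scaleC_add_left scaleC_scaleC scaleC_one)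

lemma vector_space_complex: "vector_space ((*) :: complex \<Rightarrow> complex \<Rightarrow> complex)"
  by unfold_locales (simp_all add: algebra_simps)

class complex_tvs = complex_vector + topological_ab_group_add +
  assumes tendsto_scaleC_Pair: "((\<lambda>p. fst p *\<^sub>C snd p) \<longlongrightarrow> c *\<^sub>C x) (nhds c \<times>\<^sub>F nhds x)"

class conjg =
  fixes conjg :: "'a \<Rightarrow> 'a"

text \<open>
  Complex topological vector spaces with a complex conjugation (a continuous antilinear
  involution) and a jointly continuous symmetric bilinear form, written \<open>\<phi>\<^sup>T \<psi>\<close> in the comments
  below, that is compatible with the conjugation and for which \<open>(conjg \<phi>)\<^sup>T \<psi>\<close> is a positive
  definite Hermitian inner product.  (The Hermitian symmetry follows from symmetry and
  compatibility.)
\<close>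

class conj_tvs = complex_tvs + conjg +
  fixes bform :: "'a \<Rightarrow> 'a \<Rightarrow> complex"
  assumes conjg_add: "conjg (x + y) = conjg x + conjg y"
    and conjg_scaleC: "conjg (c *\<^sub>C x) = cnj c *\<^sub>C conjg x"
    and conjg_conjg: "conjg (conjg x) = x"
    and tendsto_conjg: "(conjg \<longlongrightarrow> conjg x) (nhds x)"
    and bform_add_left: "bform (x + y) z = bform x z + bform y z"
    and bform_scaleC_left: "bform (c *\<^sub>C x) z = c * bform x z"
    and bform_sym: "bform x y = bform y x"
    and tendsto_bform_Pair: "((\<lambda>p. bform (fst p) (snd p)) \<longlongrightarrow> bform x y) (nhds x \<times>\<^sub>F nhds y)"
    and bform_conjg: "bform (conjg x) (conjg y) = cnj (bform x y)"
    and bform_pos_real: "bform (conjg x) x \<in> \<real>"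
    and bform_pos: "x \<noteq> 0 \<Longrightarrow> Re (bform (conjg x) x) > 0"

definition Lin :: "('a::complex_tvs \<Rightarrow> 'b::complex_tvs) set" where
  "Lin = {A. Vector_Spaces.linear scaleC scaleC A \<and> continuous_on UNIV A}"

text \<open>
  The continuous dual.  Its elements are complex linear (not antilinear), so the pairing
  \<open>\<phi>\<^sup>T \<xi> = \<xi>\<^sup>T \<phi>\<close> of \<open>\<phi> :: 'a\<close> and \<open>\<xi> :: 'a dual\<close> is \<open>dual_apply \<xi> \<phi>\<close>.
\<close>

typedef (overloaded) 'a dual =
    "{f :: 'a::complex_tvs \<Rightarrow> complex. Vector_Spaces.linear scaleC (*) f \<and> continuous_on UNIV f}"
  morphisms dual_apply Abs_dual
proof
  show "(\<lambda>_. 0) \<in> {f :: 'a \<Rightarrow> complex. Vector_Spaces.linear scaleC (*) f \<and> continuous_on UNIV f}"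
    by (simp add: Vector_Spaces.linear_def module_hom_def module_hom_axioms_def
        vector_space_scaleC vector_space_complex module_iff_vector_space)
qed

setup_lifting type_definition_dual

lemma linear_functional_iff:
  "Vector_Spaces.linear scaleC (*) (f :: 'a::complex_vector \<Rightarrow> complex) \<longleftrightarrow>
    (\<forall>x y. f (x + y) = f x + f y) \<and> (\<forall>c x. f (c *\<^sub>C x) = c * f x)"
  by (auto simp add: Vector_Spaces.linear_def module_hom_def module_hom_axioms_def
      vector_space_scaleC vector_space_complex module_iff_vector_space)

lemma linear_scaleC_iff:
  "Vector_Spaces.linear scaleC scaleC (f :: 'a::complex_vector \<Rightarrow> 'b::complex_vector) \<longleftrightarrow>
    (\<forall>x y. f (x + y) = f x + f y) \<and> (\<forall>c x. f (c *\<^sub>C x) = c *\<^sub>C f x)"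
  by (auto simp add: Vector_Spaces.linear_def module_hom_def module_hom_axioms_def
      vector_space_scaleC module_iff_vector_space)

lemma dual_apply_add: "dual_apply \<xi> (x + y) = dual_apply \<xi> x + dual_apply \<xi> y"
  and dual_apply_scaleC: "dual_apply \<xi> (c *\<^sub>C x) = c * dual_apply \<xi> x"
  and continuous_dual_apply: "continuous_on UNIV (dual_apply \<xi>)"
  using dual_apply[of \<xi>] by (simp_all add: linear_functional_iff)

lemma dual_eqI: "(\<And>x. dual_apply \<xi> x = dual_apply \<omega> x) \<Longrightarrow> \<xi> = \<omega>"
  by (metis dual_apply_inject ext)

instantiation dual :: (complex_tvs) complex_vector
begin
lift_definition zero_dual :: "'a dual" is "\<lambda>_. 0"
  by (simp add: linear_functional_iff)
lift_definition plus_dual :: "'a dual \<Rightarrow> 'a dual \<Rightarrow> 'a dual" is "\<lambda>f g x. f x + g x"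
  by (auto simp: linear_functional_iff algebra_simps intro!: continuous_intros)
lift_definition minus_dual :: "'a dual \<Rightarrow> 'a dual \<Rightarrow> 'a dual" is "\<lambda>f g x. f x - g x"
  by (auto simp: linear_functional_iff algebra_simps intro!: continuous_intros)
lift_definition uminus_dual :: "'a dual \<Rightarrow> 'a dual" is "\<lambda>f x. - f x"
  by (auto simp: linear_functional_iff algebra_simps intro!: continuous_intros)
lift_definition scaleC_dual :: "complex \<Rightarrow> 'a dual \<Rightarrow> 'a dual" is "\<lambda>c f x. c * f x"
  by (auto simp: linear_functional_iff algebra_simps intro!: continuous_intros)
instance
  by standard (transfer; simp add: algebra_simps fun_eq_iff)+
end

lemma continuous_on_conjg: "continuous_on UNIV (conjg :: 'a::conj_tvs \<Rightarrow> 'a)"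
  by (meson at_within_le_nhds continuous_on_def filterlim_mono order_refl tendsto_conjg)

text \<open>On the dual, the conjugate functional is \<open>\<phi> \<mapsto> cnj (\<xi>\<^sup>T (conjg \<phi>))\<close>.\<close>

instantiation dual :: (conj_tvs) conjg
begin
lift_definition conjg_dual :: "'a dual \<Rightarrow> 'a dual" is "\<lambda>f x. cnj (f (conjg x))"
  by (auto simp: linear_functional_iff conjg_add conjg_scaleC
      intro!: continuous_intros continuous_on_compose2[OF _ continuous_on_conjg])
instance ..
end

text \<open>The embedding of the space into its dual by means of the bilinear form.\<close>

lift_definition to_dual :: "'a::conj_tvs \<Rightarrow> 'a dual" is bform
proof (intro conjI)
  fix x :: 'a
  show "Vector_Spaces.linear scaleC (*) (bform x)"
    unfolding linear_functional_iff
    by (metis bform_add_left bform_scaleC_left bform_sym)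
  have "(bform x \<longlongrightarrow> bform x y) (nhds y)" for y
  proof -
    have "filterlim (\<lambda>y. (x, y)) (nhds x \<times>\<^sub>F nhds y) (nhds y)"
      by (simp add: filterlim_Pair filterlim_ident)
    from filterlim_compose[OF tendsto_bform_Pair this] show ?thesis
      by simp
  qed
  then show "continuous_on UNIV (bform x)"
    by (meson at_within_le_nhds continuous_on_def filterlim_mono order_refl)
qed

lemma inj_to_dual: "inj (to_dual :: 'a::conj_tvs \<Rightarrow> 'a dual)"
proof (rule injI)
  fix x y :: 'a
  assume "to_dual x = to_dual y"
  then have eq: "bform x z = bform y z" for z
    by (metis to_dual.rep_eq)
  have "bform (conjg (x - y)) (x - y) = 0"
    using bform_add_left[of "x - y" y "conjg (x - y)"] eq[of "conjg (x - y)"]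
    by (simp add: bform_sym)
  then show "x = y"
    by (metis bform_pos eq_iff_diff_eq_0 less_irrefl zero_complex.simps(1))
qed

definition sym_op :: "('a::conj_tvs \<Rightarrow> 'a) \<Rightarrow> bool" where
  "sym_op A \<longleftrightarrow> (\<forall>\<phi> \<psi>. bform (A \<phi>) \<psi> = bform \<phi> (A \<psi>))"

text \<open>
  The extension \<open>\<phi>\<^sup>T A \<xi> = (A \<phi>)\<^sup>T \<xi>\<close> of a symmetric \<open>A \<in> Lin\<close> to the dual.
\<close>

definition dual_ext :: "('a::complex_tvs \<Rightarrow> 'a) \<Rightarrow> 'a dual \<Rightarrow> 'a dual" where
  "dual_ext A \<xi> = Abs_dual (\<lambda>\<phi>. dual_apply \<xi> (A \<phi>))"

lemma dual_apply_dual_ext: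
  assumes "A \<in> Lin"
  shows "dual_apply (dual_ext A \<xi>) \<phi> = dual_apply \<xi> (A \<phi>)"
proof -
  have "continuous_on UNIV (\<lambda>\<phi>. dual_apply \<xi> (A \<phi>))"
    using assms by (auto simp: Lin_def intro: continuous_on_compose2[OF continuous_dual_apply])
  then show ?thesis
    using assms unfolding dual_ext_def
    by (subst Abs_dual_inverse)
      (auto simp: Lin_def linear_functional_iff linear_scaleC_iff dual_apply_add dual_apply_scaleC)
qed

lemma dual_ext_to_dual:
  assumes "A \<in> Lin" "sym_op A"
  shows "dual_ext A (to_dual \<phi>) = to_dual (A \<phi>)"
  using assms by (intro dual_eqI) (simp add: dual_apply_dual_ext to_dual.rep_eq sym_op_def)

text \<open>
  For maps \<open>S\<close> between duals that send embedded vectors to embedded vectors, \<open>core S\<close> is the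
  induced map between the original spaces.
\<close>

definition preserves_core :: "('k::conj_tvs dual \<Rightarrow> 'h::conj_tvs dual) \<Rightarrow> bool" where
  "preserves_core S \<longleftrightarrow> S ` range to_dual \<subseteq> range to_dual"

definition core :: "('k::conj_tvs dual \<Rightarrow> 'h::conj_tvs dual) \<Rightarrow> 'k \<Rightarrow> 'h" where
  "core S \<eta> = inv to_dual (S (to_dual \<eta>))"

lemma to_dual_core: "preserves_core S \<Longrightarrow> to_dual (core S \<eta>) = S (to_dual \<eta>)"
  by (simp add: core_def preserves_core_def f_inv_into_f image_subset_iff)

text \<open>
  The two equations are \<open>(T \<psi>)\<^sup>T \<eta> = \<psi>\<^sup>T S \<eta>\<close> for \<open>\<psi>\<close> in the dual of \<open>'h\<close> and \<open>\<eta>\<close> in \<open>'k\<close>, and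
  \<open>(T \<phi>)\<^sup>T \<xi> = \<phi>\<^sup>T S \<xi>\<close> for \<open>\<phi>\<close> in \<open>'h\<close> and \<open>\<xi>\<close> in the dual of \<open>'k\<close>.
\<close>

definition is_transpose ::
    "('k::conj_tvs dual \<Rightarrow> 'h::conj_tvs dual) \<Rightarrow> ('h dual \<Rightarrow> 'k dual) \<Rightarrow> bool" where
  "is_transpose S T \<longleftrightarrow> preserves_core T \<and>
    (\<forall>\<psi> \<eta>. dual_apply (T \<psi>) \<eta> = dual_apply \<psi> (core S \<eta>)) \<and>
    (\<forall>\<phi> \<xi>. dual_apply \<xi> (core T \<phi>) = dual_apply (S \<xi>) \<phi>)"

definition dual_map :: "('k::conj_tvs dual \<Rightarrow> 'h::conj_tvs dual) \<Rightarrow> bool" where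
  "dual_map S \<longleftrightarrow>
    Vector_Spaces.linear scaleC scaleC S \<and> preserves_core S \<and> (\<exists>T. is_transpose S T)"

definition transpose_op ::
    "('k::conj_tvs dual \<Rightarrow> 'h::conj_tvs dual) \<Rightarrow> 'h dual \<Rightarrow> 'k dual"
    (\<open>(_\<^sup>T)\<close> [1000] 1000) where
  "S\<^sup>T = (THE T. is_transpose S T)"

lemma is_transpose_unique: "is_transpose S T \<Longrightarrow> is_transpose S T' \<Longrightarrow> T = T'"
  by (rule ext, rule dual_eqI) (simp add: is_transpose_def)

lemma transpose_op_eq: "is_transpose S T \<Longrightarrow> S\<^sup>T = T"
  unfolding transpose_op_def by (blast intro: is_transpose_unique)

lemma is_transpose_transpose_op: "dual_map S \<Longrightarrow> is_transpose S (S\<^sup>T)"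
  unfolding dual_map_def using transpose_op_eq by blast

lemma is_transpose_dual_ext:
  assumes "A \<in> Lin" "sym_op A"
  shows "is_transpose (dual_ext A) (dual_ext A)"
proof -
  have "core (dual_ext A) \<eta> = A \<eta>" for \<eta>
    by (simp add: core_def dual_ext_to_dual[OF assms] inv_f_f[OF inj_to_dual])
  then show ?thesis
    by (auto simp: is_transpose_def preserves_core_def dual_ext_to_dual[OF assms]
        dual_apply_dual_ext[OF assms(1)])
qed

definition conj_op :: "('k::conj_tvs dual \<Rightarrow> 'h::conj_tvs dual) \<Rightarrow> 'k dual \<Rightarrow> 'h dual" where
  "conj_op S = (\<lambda>\<xi>. conjg (S (conjg \<xi>)))"

definition adjoint_op :: "('k::conj_tvs dual \<Rightarrow> 'h::conj_tvs dual) \<Rightarrow> 'h dual \<Rightarrow> 'k dual" where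
  "adjoint_op S = conj_op (S\<^sup>T)"

definition Im_op :: "('a::conj_tvs dual \<Rightarrow> 'a dual) \<Rightarrow> 'a dual \<Rightarrow> 'a dual" where
  "Im_op A = (\<lambda>\<xi>. (1 / (2 * \<i>)) *\<^sub>C (A \<xi> - adjoint_op A \<xi>))"

text \<open>
  Here \<open>\<psi>\<close> ranges over the space itself, not over its dual, and the number required to be
  real and nonnegative is \<open>(conjg \<psi>)\<^sup>T A \<psi>\<close>.
\<close>

definition pos_semidef :: "('a::conj_tvs dual \<Rightarrow> 'a dual) \<Rightarrow> bool" where
  "pos_semidef A \<longleftrightarrow> (\<forall>\<psi>. dual_apply (A (to_dual \<psi>)) (conjg \<psi>) \<in> \<real>\<^sub>\<ge>\<^sub>0)"

definition weak_star :: "'a::complex_tvs dual topology" where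
  "weak_star = pullback_topology UNIV dual_apply euclidean"

text \<open>
  ``Closed'' is meant in the sense of operators: the graph is closed.  The dual carries the weak-*
  topology.  By \<open>closed_op_dual_map\<close> below this holds for every map that has a transpose; the graph
  is then also closed for every finer topology on the duals, such as the strong one.
\<close>

definition closed_op :: "('k::complex_tvs dual \<Rightarrow> 'h::complex_tvs dual) \<Rightarrow> bool" where
  "closed_op S \<longleftrightarrow> closedin (prod_topology weak_star weak_star) (range (\<lambda>\<xi>. (\<xi>, S \<xi>)))"

lemma closed_op_dual_map:
  assumes "dual_map S"
  shows "closed_op S"
proof -
  have ts: "topspace weak_star = UNIV" by (simp add: weak_star_def topspace_pullback_topology)
  have cm: "continuous_map (weak_star :: 'x::complex_tvs dual topology) euclidean (\<lambda>\<xi>. dual_apply \<xi> x)" for x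
  proof -
    have "continuous_map (weak_star :: 'x dual topology) euclidean ((\<lambda>f. f x) \<circ> dual_apply)"
      unfolding weak_star_def by (intro continuous_map_pullback) (simp add: continuous_on_product_coordinates)
    then show ?thesis by (simp add: o_def)
  qed
  obtain T where T: "is_transpose S T" using assms dual_map_def by blast
  have eq: "range (\<lambda>\<xi>. (\<xi>, S \<xi>)) = (\<Inter>\<phi>. {p \<in> topspace (prod_topology weak_star weak_star). dual_apply (snd p) \<phi> - dual_apply (fst p) (core T \<phi>) \<in> {0}})"
  proof -
    have *: "(\<forall>\<phi>. dual_apply b \<phi> = dual_apply a (core T \<phi>)) \<longleftrightarrow> b = S a" for a b
      using T unfolding is_transpose_def by (metis dual_eqI)
    show ?thesis using T[unfolded is_transpose_def] by (auto simp: ts image_iff) (metis *)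
  qed
  have "closedin (prod_topology weak_star weak_star) {p \<in> topspace (prod_topology weak_star weak_star). dual_apply (snd p) \<phi> - dual_apply (fst p) (core T \<phi>) \<in> {0::complex}}" for \<phi>
    apply (rule closedin_continuous_map_preimage[where Y=euclidean])
     apply (intro continuous_map_diff)
    using continuous_map_compose[OF continuous_map_snd cm] continuous_map_compose[OF continuous_map_fst cm]
    by (auto simp: o_def)
  then show ?thesis unfolding closed_op_def eq by (intro closedin_INT) auto
qed

text \<open>Invertibility both on the dual and on the space embedded in it.\<close>

definition invertible_op :: "('a::conj_tvs dual \<Rightarrow> 'a dual) \<Rightarrow> bool" where
  "invertible_op A \<longleftrightarrow> bij A \<and> bij_betw A (range to_dual) (range to_dual)"

definition embedding_op :: "('k::conj_tvs dual \<Rightarrow> 'h::conj_tvs dual) \<Rightarrow> bool" where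
  "embedding_op P \<longleftrightarrow>
    dual_map P \<and> closed_op P \<and> inj P \<and> conj_op P = P \<and> invertible_op (P\<^sup>T \<circ> P)"

definition embedding_pinv :: "('k::conj_tvs dual \<Rightarrow> 'h::conj_tvs dual) \<Rightarrow> 'h dual \<Rightarrow> 'k dual" where
  "embedding_pinv P = inv (P\<^sup>T \<circ> P) \<circ> P\<^sup>T"

definition reference_op :: "('k::conj_tvs dual \<Rightarrow> 'h::conj_tvs dual) \<Rightarrow> bool" where
  "reference_op P\<^sub>0 \<longleftrightarrow>
    dual_map P\<^sub>0 \<and> closed_op P\<^sub>0 \<and> surj P\<^sub>0 \<and> invertible_op (P\<^sub>0 \<circ> P\<^sub>0\<^sup>T)"

definition reference_pinv :: "('k::conj_tvs dual \<Rightarrow> 'h::conj_tvs dual) \<Rightarrow> 'h dual \<Rightarrow> 'k dual" where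
  "reference_pinv P\<^sub>0 = P\<^sub>0\<^sup>T \<circ> inv (P\<^sub>0 \<circ> P\<^sub>0\<^sup>T)"

definition L_eff ::
    "('h::conj_tvs dual \<Rightarrow> 'h dual) \<Rightarrow> ('k::conj_tvs dual \<Rightarrow> 'h dual) \<Rightarrow> ('k dual \<Rightarrow> 'h dual) \<Rightarrow>
      'k dual \<Rightarrow> 'k dual" where
  "L_eff L P R = (\<lambda>\<xi>. P\<^sup>T (L (P \<xi>)) - R\<^sup>T (L (R \<xi>)))"

end

(*
  Since P0^T is injective, the hypothesis on R and L' reads L Q = P L' with Q = P - R. Because
  R^T P = 0, this gives L_eff = P^T L Q = Q^T L Q = P^T P L'; as P commutes with conjugation, also
  L_eff = Q^* L Q, whence (i). For (ii), both alternatives give P^T P0 psi0 = 0; transposing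
  L Q = P L' then yields Q^T L P0 psi0 = 0, so Q^T L psi = L_eff psi_eff. If this vanishes, so does
  L' psi_eff, hence L Q psi_eff = 0 and L psi = L P0 psi0.
*)

theory Submission
  imports Defs
begin

section \<open>Linearity and conjugation for the form, the pairing and the embedding\<close>

lemma bform_diff_left: "bform (x - y) z = bform x z - bform y z"
  by (metis add_diff_cancel_right' bform_add_left diff_add_cancel)

lemma conjg_diff: "conjg (x - y) = conjg x - conjg (y :: 'a::conj_tvs)"
  by (metis add_diff_cancel_right' conjg_add diff_add_cancel)

lemma dual_apply_zero: "dual_apply 0 x = 0"
  by (simp add: zero_dual.rep_eq)

lemma dual_apply_zero_right: "dual_apply \<xi> 0 = 0"
  using dual_apply_add[of \<xi> 0 0] by simp

lemma dual_apply_diff: "dual_apply \<xi> (x - y) = dual_apply \<xi> x - dual_apply \<xi> y"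
  by (metis add_diff_cancel_right' dual_apply_add diff_add_cancel)

lemma to_dual_diff: "to_dual (x - y) = to_dual x - to_dual y"
  by (rule dual_eqI) (simp add: to_dual.rep_eq minus_dual.rep_eq bform_diff_left)

lemma to_dual_zero: "to_dual 0 = 0"
  using to_dual_diff[of 0 0] by simp

lemma conjg_to_dual: "conjg (to_dual x) = to_dual (conjg x)"
  by (rule dual_eqI) (metis bform_conjg conjg_conjg conjg_dual.rep_eq to_dual.rep_eq)

section \<open>Calculus of the maps induced on the spaces themselves\<close>

lemma core_eqI: "S (to_dual \<eta>) = to_dual x \<Longrightarrow> core S \<eta> = x"
  by (simp add: core_def inv_f_f[OF inj_to_dual])

lemma core_comp:
  assumes "preserves_core S"
  shows "core (S' \<circ> S) \<eta> = core S' (core S \<eta>)"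
  by (simp add: core_def[of "S' \<circ> S"] core_def[of S'] to_dual_core[OF assms])

lemma core_diff:
  assumes "preserves_core S" "preserves_core S'"
  shows "core (\<lambda>\<xi>. S \<xi> - S' \<xi>) \<eta> = core S \<eta> - core S' \<eta>"
  by (rule core_eqI) (simp add: to_dual_diff to_dual_core assms)

lemma core_conjg:
  assumes "preserves_core S" "conj_op S = S"
  shows "core S (conjg \<eta>) = conjg (core S \<eta>)"
proof (rule core_eqI)
  have "S (to_dual (conjg \<eta>)) = conjg (S (conjg (to_dual (conjg \<eta>))))"
    using assms(2) by (metis conj_op_def)
  then show "S (to_dual (conjg \<eta>)) = to_dual (conjg (core S \<eta>))"
    by (simp add: conjg_to_dual conjg_conjg flip: to_dual_core[OF assms(1)])
qed

lemma preserves_core_comp: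
  "preserves_core S' \<Longrightarrow> preserves_core S \<Longrightarrow> preserves_core (S' \<circ> S)"
  unfolding preserves_core_def by (metis image_comp image_mono order_trans)

lemma preserves_core_diff:
  assumes "preserves_core S" "preserves_core S'"
  shows "preserves_core (\<lambda>\<xi>. S \<xi> - S' \<xi>)"
  unfolding preserves_core_def
  by (auto simp flip: to_dual_core[OF assms(1)] to_dual_core[OF assms(2)] to_dual_diff)

section \<open>Calculus of transposes\<close>

lemma is_transpose_apply:
  "is_transpose S T \<Longrightarrow> dual_apply (T \<psi>) \<eta> = dual_apply \<psi> (core S \<eta>)"
  by (simp add: is_transpose_def)

text \<open>Exchanging the two maps merely exchanges the two pairing equations, so only the
  preservation condition has to be supplied.\<close>

lemma is_transpose_sym:
  "is_transpose S T \<Longrightarrow> preserves_core S \<Longrightarrow> is_transpose T S"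
  by (simp add: is_transpose_def)

lemma is_transpose_comp:
  assumes "is_transpose S T" "is_transpose S' T'" "preserves_core S"
  shows "is_transpose (S' \<circ> S) (T \<circ> T')"
  using assms unfolding is_transpose_def
  by (simp add: preserves_core_comp core_comp)

lemma is_transpose_diff:
  assumes "is_transpose S T" "is_transpose S' T'" "preserves_core S" "preserves_core S'"
  shows "is_transpose (\<lambda>\<xi>. S \<xi> - S' \<xi>) (\<lambda>\<xi>. T \<xi> - T' \<xi>)"
  using assms unfolding is_transpose_def
  by (simp add: preserves_core_diff core_diff minus_dual.rep_eq dual_apply_diff)

text \<open>Additivity of a transpose is inherited from the pairing. This also covers
  \<open>L\<close>, being its own transpose, and \<open>P\<close>, being the transpose of its
  transpose.\<close>

lemma is_transpose_add: "is_transpose S T \<Longrightarrow> T (x + y) = T x + T y"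
  by (rule dual_eqI) (simp add: is_transpose_apply plus_dual.rep_eq)

lemma is_transpose_minus: "is_transpose S T \<Longrightarrow> T (x - y) = T x - T y"
  by (rule dual_eqI) (simp add: is_transpose_apply minus_dual.rep_eq)

lemma is_transpose_zero: "is_transpose S T \<Longrightarrow> T 0 = 0"
  by (rule dual_eqI) (simp add: is_transpose_apply zero_dual.rep_eq)

text \<open>The adjoint is the conjugated transpose: its conjugations come out of the pairing as one
  \<open>cnj\<close>, and symmetry of the form undoes the transposition.\<close>

lemma dual_apply_adjoint_op:
  assumes "is_transpose A T" "preserves_core A"
  shows "dual_apply (adjoint_op A (to_dual \<psi>)) (conjg \<psi>)
    = cnj (dual_apply (A (to_dual \<psi>)) (conjg \<psi>))"
proof -
  have "dual_apply (adjoint_op A (to_dual \<psi>)) (conjg \<psi>) = cnj (bform (conjg \<psi>) (core A \<psi>))"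
    by (simp add: adjoint_op_def conj_op_def transpose_op_eq[OF assms(1)] conjg_dual.rep_eq
        conjg_conjg conjg_to_dual is_transpose_apply[OF assms(1)] to_dual.rep_eq)
  also have "bform (conjg \<psi>) (core A \<psi>) = dual_apply (A (to_dual \<psi>)) (conjg \<psi>)"
    by (simp add: bform_sym to_dual.rep_eq flip: to_dual_core[OF assms(2)])
  finally show ?thesis .
qed

text \<open>By the previous lemma the value is \<open>(z - cnj z) / (2 * \<i>)\<close>, which is the
  real number \<open>Im z\<close>; only its sign remains to be controlled.\<close>

lemma pos_semidef_Im_op_iff:
  assumes "is_transpose A T" "preserves_core A"
  shows "pos_semidef (Im_op A) \<longleftrightarrow> (\<forall>\<psi>. 0 \<le> Im (dual_apply (A (to_dual \<psi>)) (conjg \<psi>)))"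
proof -
  have "dual_apply (Im_op A (to_dual \<psi>)) (conjg \<psi>)
      = of_real (Im (dual_apply (A (to_dual \<psi>)) (conjg \<psi>)))" for \<psi>
    by (simp add: Im_op_def scaleC_dual.rep_eq minus_dual.rep_eq dual_apply_adjoint_op[OF assms]
        complex_eq_iff)
  then show ?thesis
    by (simp add: pos_semidef_def)
qed

text \<open>These are the normal equations of least squares: the residual of \<open>\<psi>\<close>
  after projection is annihilated by \<open>P\<^sup>T\<close>.\<close>

lemma embedding_pinv_normal_eq:
  assumes "embedding_op P"
  shows "P\<^sup>T (P (embedding_pinv P \<psi>)) = P\<^sup>T \<psi>"
proof -
  have "surj (P\<^sup>T \<circ> P)"
    using assms by (metis embedding_op_def invertible_op_def bij_is_surj)
  then show ?thesis
    using surj_f_inv_f[of "P\<^sup>T \<circ> P" "P\<^sup>T \<psi>"] by (simp add: embedding_pinv_def)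
qed

lemma reference_pinv_right_inverse:
  assumes "reference_op P\<^sub>0"
  shows "P\<^sub>0 (reference_pinv P\<^sub>0 \<psi>) = \<psi>"
proof -
  have "surj (P\<^sub>0 \<circ> P\<^sub>0\<^sup>T)"
    using assms by (metis reference_op_def invertible_op_def bij_is_surj)
  then show ?thesis
    using surj_f_inv_f[of "P\<^sub>0 \<circ> P\<^sub>0\<^sup>T" \<psi>] by (simp add: reference_pinv_def)
qed

text \<open>The inner factor of an injective composition is injective. This is what allows
  \<open>P\<^sub>0\<^sup>T\<close> to be cancelled from equations.\<close>

lemma inj_transpose_reference_op:
  assumes "reference_op P\<^sub>0"
  shows "inj (P\<^sub>0\<^sup>T)"
  using assms by (metis bij_is_inj inj_on_imageI2 invertible_op_def reference_op_def)

text \<open>Tested against \<open>\<eta>\<close> in the space, both transposes move onto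
  \<open>\<eta>\<close>, where the hypothesis at \<open>to_dual \<eta>\<close> gives zero; so the
  conclusion reaches every \<open>\<xi>\<close> in the dual.\<close>

lemma transpose_orthogonal_swap:
  assumes "dual_map P" "dual_map R" "\<And>\<xi>. P\<^sup>T (R \<xi>) = 0"
  shows "R\<^sup>T (P \<xi>) = 0"
proof (rule dual_eqI)
  note tP = is_transpose_transpose_op[OF assms(1)] and tR = is_transpose_transpose_op[OF assms(2)]
  have cP: "preserves_core P" and cR: "preserves_core R"
    using assms by (simp_all add: dual_map_def)
  fix \<eta>
  have "core (P\<^sup>T) (core R \<eta>) = 0"
    by (rule core_eqI) (simp add: to_dual_core[OF cR] assms(3) to_dual_zero)
  then show "dual_apply (R\<^sup>T (P \<xi>)) \<eta> = dual_apply 0 \<eta>"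
    by (simp add: is_transpose_apply[OF tR] is_transpose_apply[OF is_transpose_sym[OF tP cP]]
        dual_apply_zero dual_apply_zero_right)
qed

theorem theorem6p3:
  fixes L\<^sub>H :: "'h::conj_tvs \<Rightarrow> 'h"
    and L :: "'h dual \<Rightarrow> 'h dual"
    and P R :: "'e::conj_tvs dual \<Rightarrow> 'h dual"
    and L' :: "'e dual \<Rightarrow> 'e dual"
    and P\<^sub>0 :: "'r::conj_tvs dual \<Rightarrow> 'h dual"
  assumes "L\<^sub>H \<in> Lin" and "sym_op L\<^sub>H" and "L = dual_ext L\<^sub>H"
    and "embedding_op P" and "reference_op P\<^sub>0"
    and "dual_map R" and "dual_map L'"
    and "\<And>\<xi>. P\<^sub>0\<^sup>T (L (R \<xi>)) + P\<^sub>0\<^sup>T (P (L' \<xi>)) = P\<^sub>0\<^sup>T (L (P \<xi>))"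
    and "\<And>\<xi>. P\<^sup>T (R \<xi>) = 0"
  shows
    "(pos_semidef (Im_op L) \<longrightarrow>
       pos_semidef (Im_op (L_eff L P R)) \<and>
       (conj_op P\<^sub>0 = P\<^sub>0 \<longrightarrow> pos_semidef (Im_op (P\<^sub>0\<^sup>T \<circ> L \<circ> P\<^sub>0))))
     \<and>
     (\<forall>\<psi> \<psi>\<^sub>e \<psi>\<^sub>0.
       (\<psi>\<^sub>e = embedding_pinv P \<psi> \<and>
          \<psi>\<^sub>0 = reference_pinv P\<^sub>0 (\<psi> - (P \<psi>\<^sub>e - R \<psi>\<^sub>e))) \<or>
       (P\<^sup>T (P\<^sub>0 \<psi>\<^sub>0) = 0 \<and> \<psi> = (P \<psi>\<^sub>e - R \<psi>\<^sub>e) + P\<^sub>0 \<psi>\<^sub>0) \<longrightarrow>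
       (L \<psi> = 0 \<longleftrightarrow> L_eff L P R \<psi>\<^sub>e = 0 \<and> P\<^sub>0\<^sup>T (L (P\<^sub>0 \<psi>\<^sub>0)) = 0))
     \<and>
     {\<psi>. L \<psi> = 0} =
       {(P \<psi>\<^sub>e - R \<psi>\<^sub>e) + P\<^sub>0 \<psi>\<^sub>0 | \<psi>\<^sub>e \<psi>\<^sub>0.
         L_eff L P R \<psi>\<^sub>e = 0 \<and> P\<^sub>0\<^sup>T (L (P\<^sub>0 \<psi>\<^sub>0)) = 0 \<and> P\<^sup>T (P\<^sub>0 \<psi>\<^sub>0) = 0}"
proof -
  note [simp] = \<open>\<And>\<xi>. P\<^sup>T (R \<xi>) = 0\<close>
  define Q where "Q = (\<lambda>\<xi>. P \<xi> - R \<xi>)"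
  have dP: "dual_map P" and dP0: "dual_map P\<^sub>0" and conjP: "conj_op P = P"
    using assms by (simp_all add: embedding_op_def reference_op_def)
  note tP = is_transpose_transpose_op[OF dP] and tP0 = is_transpose_transpose_op[OF dP0]
    and tR = is_transpose_transpose_op[OF \<open>dual_map R\<close>]
    and tL' = is_transpose_transpose_op[OF \<open>dual_map L'\<close>]
  have cP: "preserves_core P" and cP0: "preserves_core P\<^sub>0" and cR: "preserves_core R"
    and cL': "preserves_core L'"
    using dP dP0 assms by (simp_all add: dual_map_def)
  have tL: "is_transpose L L"
    using assms is_transpose_dual_ext by blast
  then have cL: "preserves_core L"
    by (simp add: is_transpose_def)
  have tQ: "is_transpose Q (\<lambda>\<xi>. P\<^sup>T \<xi> - R\<^sup>T \<xi>)" and cQ: "preserves_core Q"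
    unfolding Q_def by (intro is_transpose_diff preserves_core_diff tP tR cP cR)+
  have RTP: "R\<^sup>T (P \<xi>) = 0" for \<xi>
    using transpose_orthogonal_swap[OF dP \<open>dual_map R\<close>] by simp

  \<comment> \<open>Factorizations through \<open>Q = P - R\<close>\<close>
  have P0T_eq_0: "P\<^sub>0\<^sup>T \<xi> = 0 \<longleftrightarrow> \<xi> = 0" for \<xi>
    using inj_transpose_reference_op[OF \<open>reference_op P\<^sub>0\<close>] is_transpose_zero[OF tP0]
    by (metis injD)
  have LQ: "L (Q \<xi>) = P (L' \<xi>)" for \<xi>
  proof -
    have "P\<^sub>0\<^sup>T (L (Q \<xi>) - P (L' \<xi>)) = 0"
      using assms(8)[of \<xi>]
      by (simp add: Q_def is_transpose_minus[OF tL] is_transpose_minus[OF tP0] diff_eq_eq add.commute)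
    then show ?thesis
      by (simp add: P0T_eq_0)
  qed
  \<comment> \<open>The transposed form of \<open>LQ\<close>: both sides are transposes of the one
    map \<open>L \<circ> Q = P \<circ> L'\<close>, and transposes are unique.\<close>
  have QTL: "P\<^sup>T (L \<xi>) - R\<^sup>T (L \<xi>) = (L'\<^sup>T) (P\<^sup>T \<xi>)" for \<xi>
  proof -
    have "is_transpose (L \<circ> Q) ((\<lambda>\<xi>. P\<^sup>T \<xi> - R\<^sup>T \<xi>) \<circ> L)"
      by (rule is_transpose_comp[OF tQ tL cQ])
    moreover have "L \<circ> Q = P \<circ> L'"
      by (simp add: fun_eq_iff LQ)
    ultimately have "(\<lambda>\<xi>. P\<^sup>T \<xi> - R\<^sup>T \<xi>) \<circ> L = (L'\<^sup>T) \<circ> P\<^sup>T"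
      using is_transpose_comp[OF tL' tP cL'] is_transpose_unique by metis
    then show ?thesis
      by (simp add: fun_eq_iff)
  qed
  have Leff: "L_eff L P R \<xi> = P\<^sup>T (P (L' \<xi>))" for \<xi>
  proof -
    \<comment> \<open>At \<open>R \<xi>\<close> the right side of \<open>QTL\<close> vanishes, so
      the term \<open>R\<^sup>T L R\<close> of \<open>L_eff\<close> may be replaced by
      \<open>P\<^sup>T L R\<close>.\<close>
    have "P\<^sup>T (L (R \<xi>)) = R\<^sup>T (L (R \<xi>))"
      using QTL[of "R \<xi>"] is_transpose_zero[OF tL'] by simp
    then have "L_eff L P R \<xi> = P\<^sup>T (L (Q \<xi>))"
      by (simp add: L_eff_def Q_def is_transpose_minus[OF tL] is_transpose_minus[OF tP])
    then show ?thesis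
      by (simp add: LQ)
  qed

  \<comment> \<open>Positivity of the imaginary parts\<close>
  have Im_Leff: "pos_semidef (Im_op (L_eff L P R))" if "pos_semidef (Im_op L)"
  proof -
    have Leff_diff: "L_eff L P R = (\<lambda>\<xi>. (P\<^sup>T \<circ> (L \<circ> P)) \<xi> - (R\<^sup>T \<circ> (L \<circ> R)) \<xi>)"
      by (simp add: L_eff_def)
    have t: "is_transpose (S\<^sup>T \<circ> (L \<circ> S)) ((S\<^sup>T \<circ> L) \<circ> S)"
      and c: "preserves_core (S\<^sup>T \<circ> (L \<circ> S))"
      if "is_transpose S (S\<^sup>T)" "preserves_core S" for S :: "'e dual \<Rightarrow> 'h dual"
      using that cL tL
      by (meson is_transpose_comp is_transpose_sym preserves_core_comp is_transpose_def)+
    note tLeff = is_transpose_diff[OF t[OF tP cP] t[OF tR cR] c[OF tP cP] c[OF tR cR],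
        folded Leff_diff]
      and cLeff = preserves_core_diff[OF c[OF tP cP] c[OF tR cR], folded Leff_diff]
    \<comment> \<open>The quadratic form of \<open>L_eff\<close> at \<open>\<eta>\<close> is that of
      \<open>L\<close> at \<open>core Q \<eta>\<close>, so the sign of the imaginary part carries
      over.\<close>
    have "dual_apply (L_eff L P R (to_dual \<eta>)) (conjg \<eta>)
        = dual_apply (L (to_dual (core Q \<eta>))) (conjg (core Q \<eta>))" for \<eta>
    proof -
      define \<mu> where "\<mu> = L' (to_dual \<eta>)"
      have "P (conjg \<mu>) = conjg (P \<mu>)"
        by (metis conjP conj_op_def conjg_dual.rep_eq conjg_conjg complex_cnj_cnj dual_eqI)
      \<comment> \<open>The cross term with \<open>R\<close> vanishes. The conjugation is shifted
        from \<open>core R \<eta>\<close> onto \<open>\<mu>\<close> through \<open>P\<close>, which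
        is real, and then \<open>RTP\<close> applies.\<close>
      then have "dual_apply (P \<mu>) (conjg (core R \<eta>)) = cnj (dual_apply (P (conjg \<mu>)) (core R \<eta>))"
        by (simp add: conjg_dual.rep_eq)
      also have "\<dots> = 0"
        by (simp add: RTP dual_apply_zero flip: is_transpose_apply[OF tR])
      finally have "dual_apply (P \<mu>) (conjg (core Q \<eta>)) = dual_apply (P \<mu>) (core P (conjg \<eta>))"
        by (simp add: Q_def core_diff[OF cP cR] conjg_diff dual_apply_diff core_conjg[OF cP conjP])
      then show ?thesis
        by (simp add: to_dual_core[OF cQ] LQ Leff \<mu>_def is_transpose_apply[OF tP])
    qed
    then show ?thesis
      using that
      by (simp add: pos_semidef_Im_op_iff[OF tLeff cLeff] pos_semidef_Im_op_iff[OF tL cL])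
  qed

  have Im_P0: "pos_semidef (Im_op (P\<^sub>0\<^sup>T \<circ> L \<circ> P\<^sub>0))"
    if "pos_semidef (Im_op L)" and conjP0: "conj_op P\<^sub>0 = P\<^sub>0"
  proof -
    have cP0T: "preserves_core (P\<^sub>0\<^sup>T)"
      using tP0 by (simp add: is_transpose_def)
    have c: "preserves_core (P\<^sub>0\<^sup>T \<circ> L \<circ> P\<^sub>0)"
      by (intro preserves_core_comp cP0T cL cP0)
    have t: "is_transpose (P\<^sub>0\<^sup>T \<circ> L \<circ> P\<^sub>0) (P\<^sub>0\<^sup>T \<circ> (L \<circ> P\<^sub>0))"
      by (intro is_transpose_comp tP0 tL cP0 cL is_transpose_sym[OF tP0])
    \<comment> \<open>Since \<open>P\<^sub>0\<close> is real here, the form at \<open>\<eta>\<close>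
      is that of \<open>L\<close> at \<open>core P\<^sub>0 \<eta>\<close>.\<close>
    show ?thesis
      using that(1)
      by (simp add: pos_semidef_Im_op_iff[OF t c] pos_semidef_Im_op_iff[OF tL cL]
          is_transpose_apply[OF tP0] core_conjg[OF cP0 conjP0] flip: to_dual_core[OF cP0])
  qed

  \<comment> \<open>The kernel of \<open>L\<close>\<close>
  have kernel_iff: "L \<psi> = 0 \<longleftrightarrow> L_eff L P R \<psi>\<^sub>e = 0 \<and> P\<^sub>0\<^sup>T (L (P\<^sub>0 \<psi>\<^sub>0)) = 0"
    if orth: "P\<^sup>T (P\<^sub>0 \<psi>\<^sub>0) = 0" and \<psi>: "\<psi> = Q \<psi>\<^sub>e + P\<^sub>0 \<psi>\<^sub>0" for \<psi> \<psi>\<^sub>e \<psi>\<^sub>0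
  proof -
    have L\<psi>: "L \<psi> = P (L' \<psi>\<^sub>e) + L (P\<^sub>0 \<psi>\<^sub>0)"
      by (simp add: \<psi> is_transpose_add[OF tL] LQ)
    have "P\<^sup>T (L (P\<^sub>0 \<psi>\<^sub>0)) = R\<^sup>T (L (P\<^sub>0 \<psi>\<^sub>0))"
      using QTL[of "P\<^sub>0 \<psi>\<^sub>0"] orth is_transpose_zero[OF tL'] by simp
    \<comment> \<open>Applying \<open>Q\<^sup>T\<close> to \<open>L \<psi>\<close> removes the
      reference term by the preceding equality, and \<open>RTP\<close> leaves only
      \<open>P\<^sup>T P L' \<psi>\<^sub>e\<close>.\<close>
    then have Leff\<psi>: "L_eff L P R \<psi>\<^sub>e = P\<^sup>T (L \<psi>) - R\<^sup>T (L \<psi>)"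
      by (simp add: L\<psi> Leff is_transpose_add[OF tP] is_transpose_add[OF tR] RTP)
    \<comment> \<open>Injectivity of \<open>P\<^sup>T \<circ> P\<close> forces
      \<open>L' \<psi>\<^sub>e = 0\<close>. In either direction of the equivalence this leaves
      \<open>L \<psi> = L (P\<^sub>0 \<psi>\<^sub>0)\<close>, from which
      \<open>P\<^sub>0\<^sup>T\<close> can be cancelled.\<close>
    have "P (L' \<psi>\<^sub>e) = 0" if "L_eff L P R \<psi>\<^sub>e = 0"
    proof -
      have P_zero: "P 0 = 0"
        by (rule is_transpose_zero[OF is_transpose_sym[OF tP cP]])
      have "inj (P\<^sup>T \<circ> P)"
        using assms by (simp add: embedding_op_def invertible_op_def bij_is_inj)
      then have "L' \<psi>\<^sub>e = 0"
        using that injD[of "P\<^sup>T \<circ> P" "L' \<psi>\<^sub>e" 0]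
        by (simp add: Leff P_zero is_transpose_zero[OF tP])
      then show ?thesis
        by (simp add: P_zero)
    qed
    then show ?thesis
      using Leff\<psi> L\<psi> by (auto simp: P0T_eq_0 is_transpose_zero[OF tP] is_transpose_zero[OF tR])
  qed

  \<comment> \<open>The first alternative implies the second:
    \<open>P\<^sub>0 \<psi>\<^sub>0\<close> is the residual
    \<open>\<psi> - Q \<psi>\<^sub>e\<close>, and \<open>P\<^sup>T\<close> kills it by the normal
    equations and \<open>P\<^sup>T R = 0\<close>.\<close>
  have pinv: "P\<^sup>T (P\<^sub>0 \<psi>\<^sub>0) = 0 \<and> \<psi> = Q \<psi>\<^sub>e + P\<^sub>0 \<psi>\<^sub>0"
    if "\<psi>\<^sub>e = embedding_pinv P \<psi>" "\<psi>\<^sub>0 = reference_pinv P\<^sub>0 (\<psi> - Q \<psi>\<^sub>e)" for \<psi> \<psi>\<^sub>e \<psi>\<^sub>0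
    using that
    by (simp add: reference_pinv_right_inverse[OF \<open>reference_op P\<^sub>0\<close>] Q_def
        is_transpose_minus[OF tP] embedding_pinv_normal_eq[OF \<open>embedding_op P\<close>])

  show ?thesis
    unfolding Q_def[THEN fun_cong, symmetric]
  proof (intro conjI impI allI)
    show "{\<psi>. L \<psi> = 0} = {Q \<psi>\<^sub>e + P\<^sub>0 \<psi>\<^sub>0 | \<psi>\<^sub>e \<psi>\<^sub>0.
        L_eff L P R \<psi>\<^sub>e = 0 \<and> P\<^sub>0\<^sup>T (L (P\<^sub>0 \<psi>\<^sub>0)) = 0 \<and> P\<^sup>T (P\<^sub>0 \<psi>\<^sub>0) = 0}"
      \<comment> \<open>For a given solution \<open>\<psi>\<close> the pseudo inverses supply the
        witnesses \<open>\<psi>\<^sub>e\<close> and \<open>\<psi>\<^sub>0\<close>.\<close>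
      using pinv kernel_iff by blast
  qed (use Im_Leff Im_P0 kernel_iff pinv in blast)+
qed

end
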